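(* Let $K\ge 1$. Suppose that $f(z)=h(z)+\overline{g(z)}=\sum_{n=0}^\infty a_n z^n+\overline{\sum_{n=1}^\infty b_n z^n}$ is a sense-preserving $K$-quasiconformal harmonic mapping of the unit disk $\mathbb{D}$, where $h$ is bounded in $\mathbb{D}$. Then $$\sum_{n=0}^\infty |a_n|r^n+\sum_{n=1}^\infty |b_n|r^n\le \|h\|_\infty\quad\text{for } 0\le r\le \frac{K+1}{5K+1}.$$ The constant $(K+1)/(5K+1)$ is sharp, i.e. it cannot be replaced by a larger number: for every $r\in\left(\frac{K+1}{5K+1},1\right)$ there is such a mapping $f$ for which the inequality fails at $r$.
   Context: $\mathbb{D}=\{z\in\mathbb{C}:|z|<1\}$ and $\|h\|_\infty=\sup_{z\in\mathbb{D}}|h(z)|$. A harmonic mapping in $\mathbb{D}$ is a complex-valued function $f$ with $\Delta f=0$; it is written $f=h+\overline{g}$ with $h,g$ analytic in $\mathbb{D}$ and $g(0)=0$, where $h(z)=\sum_{n\ge0}a_nz^n$ and $g(z)=\sum_{n\ge1}b_nz^n$. It is (locally univalent and) sense-preserving if its Jacobian $J_f=|h'|^2-|g'|^2$ is positive in $\mathbb{D}$; equivalently $h'\neq0$ and the dilatation $\omega_f=g'/h'$ satisfies $|\omega_f|<1$ in $\mathbb{D}$. A sense-preserving homeomorphism $f$ of $\mathbb{D}$ onto a domain $\Omega'$, belonging to $W^{1,2}_{loc}(\mathbb{D})$, is $K$-quasiconformal ($K\ge1$) if $\frac{|f_z|+|f_{\bar z}|}{|f_z|-|f_{\bar z}|}\le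 K$ in $\mathbb{D}$; for harmonic $f=h+\overline g$ this means $|\omega_f(z)|\le k=\frac{K-1}{K+1}$ for $z\in\mathbb{D}$. *)

theory Defs
  imports "HOL-Complex_Analysis.Complex_Analysis"
begin

abbreviation unit_disc :: "complex set" ("\<D>")
  where "\<D> \<equiv> ball 0 1"

text \<open>
  The plane is identified with \<^typ>\<open>complex\<close>, so the partial derivatives with respect to
  $x$ and $y$ are the derivatives in the directions \<open>1\<close> and \<open>\<i>\<close>. They are
  only meaningful where the function is (real) differentiable. All sets \<open>S\<close> below are meant to be open.
\<close>

definition dir_deriv :: "complex \<Rightarrow> (complex \<Rightarrow> 'a::real_normed_vector) \<Rightarrow> complex \<Rightarrow> 'a"
  where "dir_deriv v f z = frechet_derivative f (at z) v"

primrec C_k_on :: "nat \<Rightarrow> complex set \<Rightarrow> (complex \<Rightarrow> 'a::real_normed_vector) \<Rightarrow> bool" where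
  "C_k_on 0 S f \<longleftrightarrow> continuous_on S f"
| "C_k_on (Suc n) S f \<longleftrightarrow>
     f differentiable_on S \<and> C_k_on n S (dir_deriv 1 f) \<and> C_k_on n S (dir_deriv \<i> f)"

definition laplacian :: "(complex \<Rightarrow> complex) \<Rightarrow> complex \<Rightarrow> complex"
  where "laplacian f z = dir_deriv 1 (dir_deriv 1 f) z + dir_deriv \<i> (dir_deriv \<i> f) z"

definition harmonic_on :: "complex set \<Rightarrow> (complex \<Rightarrow> complex) \<Rightarrow> bool"
  where "harmonic_on S f \<longleftrightarrow> C_k_on 2 S f \<and> (\<forall>z\<in>S. laplacian f z = 0)"

definition wirtinger :: "(complex \<Rightarrow> complex) \<Rightarrow> complex \<Rightarrow> complex"
  where "wirtinger f z = (dir_deriv 1 f z - \<i> * dir_deriv \<i> f z) / 2"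

definition wirtinger_bar :: "(complex \<Rightarrow> complex) \<Rightarrow> complex \<Rightarrow> complex"
  where "wirtinger_bar f z = (dir_deriv 1 f z + \<i> * dir_deriv \<i> f z) / 2"

text \<open>For \<open>f = h + cnj g\<close> this is $|h'|^2 - |g'|^2$.\<close>

definition jacobian :: "(complex \<Rightarrow> complex) \<Rightarrow> complex \<Rightarrow> real"
  where "jacobian f z = (cmod (wirtinger f z))\<^sup>2 - (cmod (wirtinger_bar f z))\<^sup>2"

definition sense_preserving_on :: "complex set \<Rightarrow> (complex \<Rightarrow> complex) \<Rightarrow> bool"
  where "sense_preserving_on S f \<longleftrightarrow> (\<forall>z\<in>S. jacobian f z > 0)"

definition test_function_on :: "complex set \<Rightarrow> (complex \<Rightarrow> real) \<Rightarrow> bool"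
  where "test_function_on S \<phi> \<longleftrightarrow>
    (\<forall>n. C_k_on n UNIV \<phi>) \<and> compact (closure {z. \<phi> z \<noteq> 0}) \<and> closure {z. \<phi> z \<noteq> 0} \<subseteq> S"

definition L2_loc_on :: "complex set \<Rightarrow> (complex \<Rightarrow> complex) \<Rightarrow> bool"
  where "L2_loc_on S u \<longleftrightarrow> (\<forall>C. compact C \<and> C \<subseteq> S \<longrightarrow>
    set_borel_measurable lebesgue C u \<and> set_integrable lebesgue C (\<lambda>z. (cmod (u z))\<^sup>2))"

definition weak_dir_deriv_on ::
    "complex set \<Rightarrow> complex \<Rightarrow> (complex \<Rightarrow> complex) \<Rightarrow> (complex \<Rightarrow> complex) \<Rightarrow> bool"
  where "weak_dir_deriv_on S v u w \<longleftrightarrow> (\<forall>\<phi>. test_function_on S \<phi> \<longrightarrow>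
    (LINT z:S|lebesgue. dir_deriv v \<phi> z *\<^sub>R u z) = - (LINT z:S|lebesgue. \<phi> z *\<^sub>R w z))"

definition W12_loc_on :: "complex set \<Rightarrow> (complex \<Rightarrow> complex) \<Rightarrow> bool"
  where "W12_loc_on S u \<longleftrightarrow> L2_loc_on S u \<and>
    (\<forall>v\<in>{1, \<i>}. \<exists>w. L2_loc_on S w \<and> weak_dir_deriv_on S v u w)"

text \<open>
  Quasiconformality for mappings that are differentiable at every point of \<open>S\<close> (as harmonic
  mappings are). The Wirtinger derivatives are then the classical ones, and the dilatation bound
  is imposed at every point. The Jacobian is positive, so the denominator below is positive.
\<close>

definition quasiconformal_on :: "real \<Rightarrow> complex set \<Rightarrow> (complex \<Rightarrow> complex) \<Rightarrow> bool"
  where "quasiconformal_on K S f \<longleftrightarrow>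
    K \<ge> 1 \<and> f differentiable_on S \<and> sense_preserving_on S f \<and>
    (\<exists>\<Omega>' f'. open \<Omega>' \<and> connected \<Omega>' \<and> homeomorphism S \<Omega>' f f') \<and>
    W12_loc_on S f \<and>
    (\<forall>z\<in>S. (cmod (wirtinger f z) + cmod (wirtinger_bar f z)) /
            (cmod (wirtinger f z) - cmod (wirtinger_bar f z)) \<le> K)"

definition canonical_representation ::
    "(complex \<Rightarrow> complex) \<Rightarrow> (complex \<Rightarrow> complex) \<Rightarrow> (complex \<Rightarrow> complex) \<Rightarrow>
     (nat \<Rightarrow> complex) \<Rightarrow> (nat \<Rightarrow> complex) \<Rightarrow> bool"
  where "canonical_representation f h g a b \<longleftrightarrow>
    h holomorphic_on \<D> \<and> g holomorphic_on \<D> \<and> g 0 = 0 \<and>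
    (\<forall>z\<in>\<D>. f z = h z + cnj (g z)) \<and>
    (\<forall>z\<in>\<D>. (\<lambda>n. a n * z ^ n) sums h z) \<and>
    (\<forall>z\<in>\<D>. (\<lambda>n. b (Suc n) * z ^ Suc n) sums g z)"

definition bounded_qc_harmonic_mapping ::
    "real \<Rightarrow> (complex \<Rightarrow> complex) \<Rightarrow> (complex \<Rightarrow> complex) \<Rightarrow> (complex \<Rightarrow> complex) \<Rightarrow>
     (nat \<Rightarrow> complex) \<Rightarrow> (nat \<Rightarrow> complex) \<Rightarrow> bool"
  where "bounded_qc_harmonic_mapping K f h g a b \<longleftrightarrow>
    harmonic_on \<D> f \<and> canonical_representation f h g a b \<and>
    sense_preserving_on \<D> f \<and> quasiconformal_on K \<D> f \<and> bounded (h ` \<D>)"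

text \<open>The supremum is meaningful only for \<open>h\<close> bounded on the disc.\<close>

definition sup_norm :: "(complex \<Rightarrow> complex) \<Rightarrow> real"
  where "sup_norm h = (SUP z\<in>\<D>. cmod (h z))"

text \<open>
  Both series converge for $0 \le r < 1$ whenever \<open>a\<close>, \<open>b\<close> are coefficients of
  power series converging on the disc. The entry \<open>b 0\<close> is never used.
\<close>

definition majorant :: "(nat \<Rightarrow> complex) \<Rightarrow> (nat \<Rightarrow> complex) \<Rightarrow> real \<Rightarrow> real"
  where "majorant a b r =
    (\<Sum>n. cmod (a n) * r ^ n) + (\<Sum>n. cmod (b (Suc n)) * r ^ Suc n)"

end

theory Submission
  imports Defs
begin

text \<open>
  Put \<open>k = (K - 1) / (K + 1)\<close> and \<open>M = sup_norm h\<close>. Two facts about power series on the disc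
  give the inequality. First, Wiener's bound
  \<open>cmod (a n) \<le> (M\<^sup>2 - (cmod (a 0))\<^sup>2) / M \<le> 2 * (M - cmod (a 0))\<close> for \<open>n \<ge> 1\<close>
  (\<open>coefficient_bound_of_norm_less\<close>) lets the tail of the majorant series of \<open>h\<close>, even after
  multiplication by a weight \<open>t\<close>, be absorbed by \<open>M - cmod (a 0)\<close> as soon as
  \<open>2 * t * r \<le> 1 - r\<close> (\<open>weighted_bohr_inequality\<close>). Second, \<open>g' = \<omega> * h'\<close> with
  \<open>cmod \<omega> \<le> k\<close>. The case \<open>t = 1\<close> of the weighted inequality, applied to \<open>\<omega>\<close>, bounds the
  majorant series of \<open>\<omega>\<close> by \<open>k\<close> for \<open>r \<le> 1/3\<close>, and majorant series are submultiplicative; hence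
  the majorant series of \<open>g\<close> is at most \<open>k\<close> times the tail of that of \<open>h\<close>
  (\<open>majorant_le_of_dilatation_bound\<close>). So the sum in the theorem is at most
  \<open>cmod (a 0)\<close> plus \<open>1 + k\<close> times the tail of \<open>h\<close>. For the weight \<open>t = 1 + k = 2 * K / (K + 1)\<close> the condition
  \<open>2 * t * r \<le> 1 - r\<close> reads exactly \<open>r \<le> (K + 1) / (5 * K + 1)\<close>, a number that is at most \<open>1/3\<close>
  because \<open>K \<ge> 1\<close>.

  For sharpness, all these estimates are attained to first order in \<open>1 - \<alpha>\<close>, as \<open>\<alpha> \<rightarrow> 1\<close>, by the disc
  automorphism \<open>h z = (\<alpha> - z) / (1 - \<alpha> * z)\<close> and \<open>g = k * (h - \<alpha>)\<close>, whose dilatation is the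
  constant \<open>k\<close>. Then \<open>f = h + cnj g\<close> is a real-affine bijection composed with \<open>h\<close>, hence a
  \<open>K\<close>-quasiconformal homeomorphism onto its image. Its local Sobolev regularity requires
  integration by parts against test functions, which is reduced to the translation invariance of
  Lebesgue measure (\<open>integral_directional_derivative_eq_0\<close>).
\<close>

section \<open>Bohr's inequality with a weight\<close>

text \<open>
  The Schwarz--Pick estimate at the origin: after scaling by \<open>M\<close>, the Moebius map that sends
  \<open>\<phi> 0 / M\<close> to \<open>0\<close> brings \<open>\<phi>\<close> into the range of the Schwarz lemma.
\<close>

lemma deriv_zero_bound_of_norm_less:
  fixes \<phi> :: "complex \<Rightarrow> complex"
  assumes hol: "\<phi> holomorphic_on \<D>" and less: "\<And>z. z \<in> \<D> \<Longrightarrow> cmod (\<phi> z) < M"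
  shows "M * cmod (deriv \<phi> 0) \<le> M\<^sup>2 - (cmod (\<phi> 0))\<^sup>2"
proof -
  have M0: "cmod (\<phi> 0) < M" using less[of 0] by simp
  then have M: "M > 0" using norm_ge_zero[of "\<phi> 0"] by linarith
  define c where "c = \<phi> 0 / M"
  have c: "cmod c < 1" using M0 M by (simp add: c_def norm_divide)
  define \<psi> where "\<psi> = (\<lambda>z. Moebius_function 0 c (\<phi> z / M))"
  have in_disc: "cmod (\<phi> z / M) < 1" if "cmod z < 1" for z
    using less[of z] M that by (simp add: norm_divide)
  have "(Moebius_function 0 c \<circ> (\<lambda>z. \<phi> z / M)) holomorphic_on \<D>"
    by (rule holomorphic_on_compose_gen[OF _ Moebius_function_holomorphic[OF c]])
      (use hol in_disc M in \<open>auto intro!: holomorphic_intros\<close>)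
  then have hol\<psi>: "\<psi> holomorphic_on \<D>" by (simp add: \<psi>_def o_def)
  have \<psi>0: "\<psi> 0 = 0" by (simp add: \<psi>_def c_def Moebius_function_eq_zero)
  have \<psi>1: "cmod (\<psi> z) < 1" if "cmod z < 1" for z
    unfolding \<psi>_def by (rule Moebius_function_norm_lt_1[OF c in_disc[OF that]])
  have le1: "cmod (deriv \<psi> 0) \<le> 1"
    by (rule Schwarz_Lemma(2)[OF hol\<psi> \<psi>0 \<psi>1, of 0]) auto
  have cc: "cnj c * c = of_real ((cmod c)\<^sup>2)"
    using complex_norm_square[of c] by (simp add: mult.commute)
  have c2: "(cmod c)\<^sup>2 < 1" using c by (simp add: power_less_one_iff)
  then have nz: "1 - cnj c * c \<noteq> 0"
    unfolding cc by (metis eq_iff_diff_eq_0 less_irrefl of_real_1 of_real_eq_iff)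
  have d\<phi>: "(\<phi> has_field_derivative deriv \<phi> 0) (at 0)"
    using hol by (intro holomorphic_derivI[of _ "\<D>"]) auto
  have c': "\<phi> 0 / M = c" by (simp add: c_def)
  have num: "((\<lambda>z. \<phi> z / M - c) has_field_derivative deriv \<phi> 0 / M) (at 0)"
    and den: "((\<lambda>z. 1 - cnj c * (\<phi> z / M)) has_field_derivative - (cnj c * (deriv \<phi> 0 / M))) (at 0)"
    using M by (auto intro!: derivative_eq_intros d\<phi>)
  have "(\<psi> has_field_derivative deriv \<phi> 0 / M / (1 - cnj c * c)) (at 0)"
    unfolding \<psi>_def Moebius_function_simple using DERIV_divide[OF num den] nz
    by (simp add: c')
  then have "deriv \<psi> 0 = deriv \<phi> 0 / M / (1 - cnj c * c)" by (rule DERIV_imp_deriv)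
  also have "1 - cnj c * c = of_real (1 - (cmod c)\<^sup>2)" by (simp add: cc)
  finally have "cmod (deriv \<phi> 0) / M / (1 - (cmod c)\<^sup>2) \<le> 1"
    using le1 M c2 abs_of_pos[of "1 - (cmod c)\<^sup>2"]
    by (simp only: norm_divide norm_of_real)
  then have "cmod (deriv \<phi> 0) / M \<le> 1 - (cmod c)\<^sup>2"
    using c2 by (simp only: pos_divide_le_eq diff_gt_0_iff_gt mult_1)
  also have "(cmod c)\<^sup>2 = (cmod (\<phi> 0))\<^sup>2 / M\<^sup>2"
    using M by (simp add: c_def norm_divide power_divide)
  finally have "M\<^sup>2 * (cmod (deriv \<phi> 0) / M) \<le> M\<^sup>2 * (1 - (cmod (\<phi> 0))\<^sup>2 / M\<^sup>2)"
    by (intro mult_left_mono) auto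
  moreover have "M\<^sup>2 * (cmod (deriv \<phi> 0) / M) = M * cmod (deriv \<phi> 0)"
    and "M\<^sup>2 * (1 - (cmod (\<phi> 0))\<^sup>2 / M\<^sup>2) = M\<^sup>2 - (cmod (\<phi> 0))\<^sup>2"
    using M by (simp_all add: power2_eq_square right_diff_distrib)
  ultimately show ?thesis by simp
qed

text \<open>
  Averaging \<open>h\<close> over the rotations by the \<open>n\<close>-th roots of unity kills every power of \<open>z\<close> whose
  exponent is not a multiple of \<open>n\<close>, so what remains is a power series in \<open>z ^ n\<close>.
\<close>

lemma root_of_unity_section:
  fixes h :: "complex \<Rightarrow> complex"
  assumes n: "n > 0" and \<zeta>: "\<zeta> = exp (2 * of_real pi * \<i> * of_nat 1 / of_nat n)"
    and sums: "\<And>z. z \<in> \<D> \<Longrightarrow> (\<lambda>m. a m * z ^ m) sums h z" and z: "z \<in> \<D>"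
  shows "(\<lambda>k. a (n * k) * (z ^ n) ^ k) sums ((\<Sum>j<n. h (\<zeta> ^ j * z)) / n)"
proof -
  have \<zeta>n: "\<zeta> ^ n = 1" unfolding \<zeta> by (rule complex_root_unity) (use n in simp)
  have norm\<zeta>: "cmod \<zeta> = 1"
    using \<zeta>n n by (metis norm_ge_zero norm_one norm_power power_eq_1_iff gr_implies_not0)
  have \<zeta>m: "\<zeta> ^ m = 1 \<longleftrightarrow> n dvd m" for m
  proof -
    have "\<zeta> ^ m = exp (2 * of_real pi * \<i> * of_nat m / of_nat n)"
      unfolding \<zeta> by (simp flip: exp_of_nat_mult add: field_simps)
    then show ?thesis using complex_root_unity_eq_1[of n m] n by simp
  qed
  have orth: "(\<Sum>j<n. (\<zeta> ^ m) ^ j) = (if n dvd m then of_nat n else 0)" for m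
  proof (cases "n dvd m")
    case True
    then have "\<zeta> ^ m = 1" by (simp add: \<zeta>m)
    then show ?thesis using True by simp
  next
    case False
    then have "\<zeta> ^ m \<noteq> 1" by (simp add: \<zeta>m)
    moreover have "(\<zeta> ^ m) ^ n = 1"
      by (simp add: \<zeta>n flip: power_mult) (simp add: mult.commute[of m] power_mult \<zeta>n)
    ultimately show ?thesis using False by (simp add: geometric_sum)
  qed
  have "(\<lambda>m. (\<Sum>j<n. a m * (\<zeta> ^ j * z) ^ m) / n) sums ((\<Sum>j<n. h (\<zeta> ^ j * z)) / n)"
    using z by (intro sums_divide sums_sum sums) (simp add: norm_mult norm_power norm\<zeta>)
  also have "(\<lambda>m. (\<Sum>j<n. a m * (\<zeta> ^ j * z) ^ m) / n) = (\<lambda>m. if n dvd m then a m * z ^ m else 0)"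
  proof
    fix m
    have "(\<Sum>j<n. a m * (\<zeta> ^ j * z) ^ m) = a m * z ^ m * (\<Sum>j<n. (\<zeta> ^ m) ^ j)"
      by (simp add: sum_distrib_left power_mult_distrib power_commutes mult_ac flip: power_mult)
    then show "(\<Sum>j<n. a m * (\<zeta> ^ j * z) ^ m) / n = (if n dvd m then a m * z ^ m else 0)"
      using n by (simp add: orth)
  qed
  finally have "(\<lambda>m. if n dvd m then a m * z ^ m else 0) sums ((\<Sum>j<n. h (\<zeta> ^ j * z)) / n)" .
  then have "(\<lambda>k. if n dvd n * k then a (n * k) * z ^ (n * k) else 0) sums
      ((\<Sum>j<n. h (\<zeta> ^ j * z)) / n)"
    by (subst sums_mono_reindex[of "\<lambda>k. n * k"]) (use n in \<open>auto simp: strict_mono_def\<close>)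
  then show ?thesis by (simp add: power_mult)
qed

text \<open>
  Wiener's bound. The root-of-unity average of \<open>h\<close> is a holomorphic function \<open>\<phi>\<close> of \<open>z ^ n\<close>
  that inherits the bound \<open>M\<close>, and \<open>a n\<close> is its first Taylor coefficient, so the case of a general
  \<open>n\<close> reduces to that of the derivative at the origin.
\<close>

lemma coefficient_bound_of_norm_less:
  fixes h :: "complex \<Rightarrow> complex"
  assumes n: "n > 0"
    and sums: "\<And>z. z \<in> \<D> \<Longrightarrow> (\<lambda>m. a m * z ^ m) sums h z"
    and less: "\<And>z. z \<in> \<D> \<Longrightarrow> cmod (h z) < M"
  shows "M * cmod (a n) \<le> M\<^sup>2 - (cmod (a 0))\<^sup>2"
proof -
  define \<zeta> where "\<zeta> = exp (2 * of_real pi * \<i> * of_nat 1 / of_nat n)"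
  have norm\<zeta>: "cmod \<zeta> = 1"
    by (simp add: \<zeta>_def norm_exp_eq_Re)
  define \<phi> where "\<phi> = (\<lambda>w. \<Sum>k. a (n * k) * w ^ k)"
  have section_sums: "(\<lambda>k. a (n * k) * w ^ k) sums \<phi> w" and section_less: "cmod (\<phi> w) < M"
    if w: "w \<in> \<D>" for w
  proof -
    obtain z where zw: "w = z ^ n"
      using n by (metis exists_complex_root gr_implies_not0)
    have z: "z \<in> \<D>"
      using w n by (simp add: zw norm_power power_less_one_iff)
    have s: "(\<lambda>k. a (n * k) * w ^ k) sums ((\<Sum>j<n. h (\<zeta> ^ j * z)) / n)"
      unfolding zw by (rule root_of_unity_section[OF n \<zeta>_def sums z])
    then show "(\<lambda>k. a (n * k) * w ^ k) sums \<phi> w"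
      unfolding \<phi>_def by (simp add: sums_iff)
    have "cmod (\<Sum>j<n. h (\<zeta> ^ j * z)) \<le> (\<Sum>j<n. cmod (h (\<zeta> ^ j * z)))" by (rule norm_sum)
    also have "\<dots> < (\<Sum>j<n. M)"
      using z n by (intro sum_strict_mono less) (auto simp: norm_mult norm_power norm\<zeta>)
    finally have "cmod ((\<Sum>j<n. h (\<zeta> ^ j * z)) / n) < M"
      using n by (simp add: norm_divide field_simps)
    then show "cmod (\<phi> w) < M" using s by (simp add: \<phi>_def sums_iff)
  qed
  have hol: "\<phi> holomorphic_on \<D>"
    by (rule power_series_holomorphic) (use section_sums in simp)
  have fps: "\<phi> has_fps_expansion Abs_fps (\<lambda>k. a (n * k))"
    by (rule has_fps_expansionI)
      (use section_sums in \<open>auto intro!: eventually_nhds_in_open[of "\<D>" 0, THEN eventually_mono]\<close>)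
  have "\<phi> 0 = a 0" "deriv \<phi> 0 = a n"
    using fps_nth_fps_expansion[OF fps, of 0] fps_nth_fps_expansion[OF fps, of 1] by auto
  with deriv_zero_bound_of_norm_less[OF hol section_less] show ?thesis by simp
qed

lemma summable_norm_of_sums_on_disc:
  fixes h :: "complex \<Rightarrow> complex"
  assumes sums: "\<And>z. z \<in> \<D> \<Longrightarrow> (\<lambda>m. a m * z ^ m) sums h z"
    and r: "0 \<le> r" "r < 1"
  shows "summable (\<lambda>n. cmod (a n) * r ^ n)"
proof -
  define x where "x = complex_of_real ((1 + r) / 2)"
  have nx: "norm x = (1 + r) / 2"
    using r by (simp add: x_def norm_of_real del: of_real_divide of_real_add)
  then have "summable (\<lambda>n. a n * x ^ n)"
    using sums[of x] r by (simp add: sums_iff)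
  from powser_insidea[OF this, of "complex_of_real r"] show ?thesis
    using r nx by (simp add: norm_mult norm_power)
qed

text \<open>
  Bohr's inequality is the case \<open>t = 1\<close>, where the condition on \<open>r\<close> says \<open>r \<le> 1/3\<close>. The weight
  accounts for the contribution of the co-analytic part of a harmonic mapping.
\<close>

lemma weighted_bohr_inequality:
  fixes h :: "complex \<Rightarrow> complex"
  assumes sums: "\<And>z. z \<in> \<D> \<Longrightarrow> (\<lambda>m. a m * z ^ m) sums h z"
    and le: "\<And>z. z \<in> \<D> \<Longrightarrow> cmod (h z) \<le> M"
    and r: "0 \<le> r" "r < 1" and t: "0 \<le> t" "2 * t * r \<le> 1 - r"
  shows "cmod (a 0) + t * (\<Sum>n. cmod (a (Suc n)) * r ^ Suc n) \<le> M"
proof (rule field_le_epsilon)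
  fix e :: real assume e: "e > 0"
  \<comment> \<open>Wiener's bound needs a strict inequality, which also makes the bound positive when \<open>h\<close> vanishes.\<close>
  define N where "N = M + e"
  have lessN: "cmod (h z) < N" if "z \<in> \<D>" for z using le[OF that] e by (simp add: N_def)
  have "h 0 = a 0" using sums[of 0] powser_sums_zero_iff[of a] by fastforce
  then have a0: "cmod (a 0) < N" using lessN[of 0] by simp
  then have N: "N > 0" using norm_ge_zero[of "a 0"] by linarith
  define C where "C = (N\<^sup>2 - (cmod (a 0))\<^sup>2) / N"
  have aC: "cmod (a (Suc n)) \<le> C" for n
    using coefficient_bound_of_norm_less[OF _ sums lessN, of "Suc n"] N
    by (simp add: C_def field_simps)
  have C0: "0 \<le> C" using aC[of 0] norm_ge_zero[of "a (Suc 0)"] by linarith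
  \<comment> \<open>Factor the difference of squares and use \<open>cmod (a 0) < N\<close>.\<close>
  have "C = (N - cmod (a 0)) * ((N + cmod (a 0)) / N)"
    by (simp add: C_def power2_eq_square algebra_simps)
  also have "\<dots> \<le> (N - cmod (a 0)) * 2"
    using a0 N by (intro mult_left_mono) (auto simp: field_simps)
  finally have C2: "C \<le> (N - cmod (a 0)) * 2" .
  have geo: "(\<lambda>n. C * r ^ Suc n) sums (C * (r / (1 - r)))"
    using sums_mult[OF geometric_sums[of r], of "C * r"] r by (simp add: mult_ac)
  have summ: "summable (\<lambda>n. cmod (a (Suc n)) * r ^ Suc n)"
    using summable_norm_of_sums_on_disc[OF sums r]
      summable_Suc_iff[of "\<lambda>n. cmod (a n) * r ^ n"] by simp
  have "(\<Sum>n. cmod (a (Suc n)) * r ^ Suc n) \<le> C * (r / (1 - r))"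
    using suminf_le[OF _ summ, of "\<lambda>n. C * r ^ Suc n"] geo aC r
    by (simp add: sums_iff mult_right_mono)
  then have "t * (\<Sum>n. cmod (a (Suc n)) * r ^ Suc n) \<le> t * (C * (r / (1 - r)))"
    using t by (intro mult_left_mono)
  also have "\<dots> = C * (t * r / (1 - r))" by (simp add: mult_ac)
  also have "\<dots> \<le> C * (1 / 2)"
    using t r C0 by (intro mult_left_mono) (auto simp: field_simps)
  also have "\<dots> \<le> N - cmod (a 0)" using C2 by simp
  finally show "cmod (a 0) + t * (\<Sum>n. cmod (a (Suc n)) * r ^ Suc n) \<le> M + e"
    by (simp add: N_def)
qed

section \<open>Majorant series and the dilatation\<close>

text \<open>
  The dilatation \<open>\<omega> = g' / h'\<close> is bounded by \<open>k\<close>, so by Bohr's inequality its majorant series is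
  at most \<open>k\<close> for \<open>r \<le> 1/3\<close>. Comparing coefficients in \<open>g' = \<omega> * h'\<close> gives
  \<open>(n + 1) * b (n + 1)\<close> as a convolution with factors \<open>(n - i + 1) * a (n - i + 1)\<close>. Since
  \<open>n - i + 1 \<le> n + 1\<close>, the factors coming from differentiation only help and can be
  cancelled coefficientwise, which replaces an integration over \<open>[0, r]\<close>.
\<close>

lemma majorant_le_of_dilatation_bound:
  fixes h g :: "complex \<Rightarrow> complex"
  assumes hol: "h holomorphic_on \<D>" "g holomorphic_on \<D>"
    and h_sums: "\<And>z. z \<in> \<D> \<Longrightarrow> (\<lambda>n. a n * z ^ n) sums h z"
    and g_sums: "\<And>z. z \<in> \<D> \<Longrightarrow> (\<lambda>n. b (Suc n) * z ^ Suc n) sums g z"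
    and nz: "\<And>z. z \<in> \<D> \<Longrightarrow> deriv h z \<noteq> 0"
    and dil: "\<And>z. z \<in> \<D> \<Longrightarrow> cmod (deriv g z) \<le> k * cmod (deriv h z)"
    and r: "0 \<le> r" "r \<le> 1 / 3"
  shows "(\<Sum>n. cmod (b (Suc n)) * r ^ Suc n) \<le> k * (\<Sum>n. cmod (a (Suc n)) * r ^ Suc n)"
proof -
  define \<omega> where "\<omega> = (\<lambda>z. deriv g z / deriv h z)"
  define c where "c = fps_nth (fps_expansion \<omega> 0)"
  have hol\<omega>: "\<omega> holomorphic_on \<D>"
    unfolding \<omega>_def using hol nz by (intro holomorphic_intros) auto
  have \<omega>_le: "cmod (\<omega> z) \<le> k" if "z \<in> \<D>" for z
    using dil[OF that] nz[OF that] by (simp add: \<omega>_def norm_divide field_simps)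
  have \<omega>_sums: "(\<lambda>n. c n * z ^ n) sums \<omega> z" if "z \<in> \<D>" for z
    using holomorphic_power_series[OF hol\<omega> that] by (simp add: c_def fps_expansion_def)
  have r1: "r < 1" using r by simp
  have c_summ: "summable (\<lambda>n. cmod (c n) * r ^ n)"
    by (rule summable_norm_of_sums_on_disc[OF \<omega>_sums r(1) r1])
  have "cmod (c 0) + 1 * (\<Sum>n. cmod (c (Suc n)) * r ^ Suc n) \<le> k"
    by (rule weighted_bohr_inequality[OF \<omega>_sums \<omega>_le r(1) r1]) (use r in auto)
  moreover have "(\<Sum>n. cmod (c n) * r ^ n) = cmod (c 0) + (\<Sum>n. cmod (c (Suc n)) * r ^ Suc n)"
    using suminf_split_head[OF c_summ] by simp
  ultimately have c_le: "(\<Sum>n. cmod (c n) * r ^ n) \<le> k" by simp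

  \<comment> \<open>The value \<open>b 0\<close> is arbitrary, while the series of \<open>g\<close> has constant term \<open>0\<close>.\<close>
  define b' where "b' = (\<lambda>n. if n = 0 then 0 else b n)"
  have ev: "eventually (\<lambda>u. u \<in> \<D>) (nhds 0)"
    by (intro eventually_nhds_in_open) auto
  have b'_sums: "(\<lambda>n. b' n * z ^ n) sums g z" if "z \<in> \<D>" for z
    using sums_Suc_iff[of "\<lambda>n. b' n * z ^ n" "g z"] g_sums[OF that] by (simp add: b'_def)
  have fps_h: "h has_fps_expansion Abs_fps a"
    by (rule has_fps_expansionI, rule eventually_mono[OF ev]) (simp add: h_sums)
  have fps_g: "g has_fps_expansion Abs_fps b'"
    by (rule has_fps_expansionI, rule eventually_mono[OF ev]) (simp add: b'_sums)
  have fps_\<omega>: "\<omega> has_fps_expansion Abs_fps c"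
    by (rule has_fps_expansionI, rule eventually_mono[OF ev]) (simp add: \<omega>_sums)
  have "(\<lambda>z. \<omega> z * deriv h z) has_fps_expansion Abs_fps c * fps_deriv (Abs_fps a)"
    by (intro fps_expansion_intros fps_\<omega> fps_h)
  then have "deriv g has_fps_expansion Abs_fps c * fps_deriv (Abs_fps a)"
    by (rule has_fps_expansion_cong[THEN iffD1, rotated 2])
      (use nz in \<open>auto simp: \<omega>_def intro!: eventually_mono[OF ev]\<close>)
  then have fps_eq: "fps_deriv (Abs_fps b') = Abs_fps c * fps_deriv (Abs_fps a)"
    by (rule fps_expansion_unique_complex[OF has_fps_expansion_deriv[OF fps_g]])
  have conv: "cmod (b (Suc n)) \<le> (\<Sum>i\<le>n. cmod (c i) * cmod (a (Suc (n - i))))" for n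
  proof -
    have "of_nat (Suc n) * b (Suc n) = (\<Sum>i\<le>n. c i * (of_nat (Suc (n - i)) * a (Suc (n - i))))"
      using arg_cong[OF fps_eq, of "\<lambda>F. fps_nth F n"]
      by (simp add: fps_mult_nth b'_def atLeast0AtMost)
    then have "Suc n * cmod (b (Suc n)) =
        cmod (\<Sum>i\<le>n. c i * (of_nat (Suc (n - i)) * a (Suc (n - i))))"
      by (metis norm_mult norm_of_nat)
    also have "\<dots> \<le> (\<Sum>i\<le>n. cmod (c i * (of_nat (Suc (n - i)) * a (Suc (n - i)))))"
      by (rule norm_sum)
    also have "\<dots> \<le> (\<Sum>i\<le>n. Suc n * (cmod (c i) * cmod (a (Suc (n - i)))))"
    proof (rule sum_mono)
      fix i
      have "real (Suc (n - i)) * (cmod (c i) * cmod (a (Suc (n - i)))) \<le>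
          Suc n * (cmod (c i) * cmod (a (Suc (n - i))))"
        by (intro mult_right_mono) auto
      then show "cmod (c i * (of_nat (Suc (n - i)) * a (Suc (n - i)))) \<le>
          Suc n * (cmod (c i) * cmod (a (Suc (n - i))))"
        by (simp add: norm_mult mult_ac del: of_nat_Suc)
    qed
    also have "\<dots> = Suc n * (\<Sum>i\<le>n. cmod (c i) * cmod (a (Suc (n - i))))"
      by (simp only: sum_distrib_left)
    finally show ?thesis by (simp del: of_nat_Suc)
  qed
  have a_summ: "summable (\<lambda>n. cmod (a (Suc n)) * r ^ Suc n)"
    using summable_norm_of_sums_on_disc[OF h_sums r(1) r1]
      summable_Suc_iff[of "\<lambda>n. cmod (a n) * r ^ n"] by simp
  have b_summ: "summable (\<lambda>n. cmod (b (Suc n)) * r ^ Suc n)"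
    using summable_norm_of_sums_on_disc[OF b'_sums r(1) r1]
      summable_Suc_iff[of "\<lambda>n. cmod (b' n) * r ^ n"] by (simp add: b'_def)
  have prod: "(\<lambda>n. \<Sum>i\<le>n. cmod (c i) * r ^ i * (cmod (a (Suc (n - i))) * r ^ Suc (n - i))) sums
      ((\<Sum>n. cmod (c n) * r ^ n) * (\<Sum>n. cmod (a (Suc n)) * r ^ Suc n))"
    by (rule Cauchy_product_sums) (use a_summ c_summ r in \<open>simp_all add: norm_mult\<close>)
  have "cmod (b (Suc n)) * r ^ Suc n \<le>
      (\<Sum>i\<le>n. cmod (c i) * r ^ i * (cmod (a (Suc (n - i))) * r ^ Suc (n - i)))" for n
  proof -
    have "cmod (b (Suc n)) * r ^ Suc n \<le>
        (\<Sum>i\<le>n. cmod (c i) * cmod (a (Suc (n - i)))) * r ^ Suc n"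
      using r by (intro mult_right_mono conv) auto
    also have "\<dots> = (\<Sum>i\<le>n. cmod (c i) * r ^ i * (cmod (a (Suc (n - i))) * r ^ Suc (n - i)))"
      unfolding sum_distrib_right
    proof (rule sum.cong[OF refl])
      fix i assume "i \<in> {..n}"
      then have "r ^ Suc n = r ^ i * r ^ Suc (n - i)" by (simp flip: power_add)
      then show "cmod (c i) * cmod (a (Suc (n - i))) * r ^ Suc n =
          cmod (c i) * r ^ i * (cmod (a (Suc (n - i))) * r ^ Suc (n - i))"
        by (simp only: mult_ac)
    qed
    finally show ?thesis .
  qed
  then have "(\<Sum>n. cmod (b (Suc n)) * r ^ Suc n) \<le>
      (\<Sum>n. cmod (c n) * r ^ n) * (\<Sum>n. cmod (a (Suc n)) * r ^ Suc n)"
    by (subst sums_unique[OF prod]) (rule suminf_le[OF _ b_summ sums_summable[OF prod]])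
  also have "\<dots> \<le> k * (\<Sum>n. cmod (a (Suc n)) * r ^ Suc n)"
    using c_le a_summ r by (intro mult_right_mono suminf_nonneg) auto
  finally show ?thesis .
qed

section \<open>Harmonic functions of the form \<open>h + cnj g\<close>\<close>

lemma dir_deriv_holomorphic_plus_cnj:
  assumes S: "open S" "z \<in> S" and hol: "h holomorphic_on S" "g holomorphic_on S"
    and f: "\<And>z. z \<in> S \<Longrightarrow> f z = h z + cnj (g z)"
  shows "(f has_derivative (\<lambda>v. v * deriv h z + cnj (v * deriv g z))) (at z)"
    and "dir_deriv v f z = v * deriv h z + cnj (v * deriv g z)"
proof -
  have "(h has_derivative (\<lambda>v. v * deriv h z)) (at z)" "(g has_derivative (\<lambda>v. v * deriv g z)) (at z)"
    using holomorphic_derivI[OF hol(1) S] holomorphic_derivI[OF hol(2) S]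
    by (simp_all add: has_field_derivative_def mult_commute_abs)
  then have "((\<lambda>z. h z + cnj (g z)) has_derivative (\<lambda>v. v * deriv h z + cnj (v * deriv g z))) (at z)"
    by (intro derivative_intros)
  then show *: "(f has_derivative (\<lambda>v. v * deriv h z + cnj (v * deriv g z))) (at z)"
    by (rule has_derivative_transform_within_open[OF _ S]) (simp add: f)
  show "dir_deriv v f z = v * deriv h z + cnj (v * deriv g z)"
    unfolding dir_deriv_def using frechet_derivative_at[OF *] by metis
qed

lemma wirtinger_holomorphic_plus_cnj:
  assumes S: "open S" "z \<in> S" and hol: "h holomorphic_on S" "g holomorphic_on S"
    and f: "\<And>z. z \<in> S \<Longrightarrow> f z = h z + cnj (g z)"
  shows "wirtinger f z = deriv h z" and "wirtinger_bar f z = cnj (deriv g z)"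
proof -
  have "dir_deriv v f z = v * deriv h z + cnj (v * deriv g z)" for v
    by (rule dir_deriv_holomorphic_plus_cnj(2)[OF S hol f])
  then show "wirtinger f z = deriv h z" "wirtinger_bar f z = cnj (deriv g z)"
    by (simp_all add: wirtinger_def wirtinger_bar_def algebra_simps)
qed

text \<open>
  The class of functions \<open>h + cnj g\<close> is closed under directional derivatives: differentiating in
  direction \<open>v\<close> replaces \<open>h\<close>, \<open>g\<close> by \<open>v * h'\<close>, \<open>v * g'\<close>. This drives the induction.
\<close>

lemma C_k_on_holomorphic_plus_cnj:
  assumes S: "open S" and hol: "h holomorphic_on S" "g holomorphic_on S"
    and f: "\<And>z. z \<in> S \<Longrightarrow> f z = h z + cnj (g z)"
  shows "C_k_on n S f"
  using hol f
proof (induction n arbitrary: f h g)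
  case 0
  have "f differentiable_on S"
    unfolding differentiable_on_eq_differentiable_at[OF S] differentiable_def
    using dir_deriv_holomorphic_plus_cnj(1)[OF S _ 0] by blast
  then show ?case by (simp add: differentiable_imp_continuous_on)
next
  case (Suc n)
  have "f differentiable_on S"
    unfolding differentiable_on_eq_differentiable_at[OF S] differentiable_def
    using dir_deriv_holomorphic_plus_cnj(1)[OF S _ Suc.prems] by blast
  moreover have "C_k_on n S (dir_deriv v f)" for v
  proof (rule Suc.IH)
    show "(\<lambda>z. v * deriv h z) holomorphic_on S" "(\<lambda>z. v * deriv g z) holomorphic_on S"
      using Suc.prems S by (auto intro!: holomorphic_intros)
    show "dir_deriv v f z = v * deriv h z + cnj (v * deriv g z)" if "z \<in> S" for z
      by (rule dir_deriv_holomorphic_plus_cnj(2)[OF S that Suc.prems])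
  qed
  ultimately show ?case by simp
qed

lemma harmonic_on_holomorphic_plus_cnj:
  assumes S: "open S" and hol: "h holomorphic_on S" "g holomorphic_on S"
    and f: "\<And>z. z \<in> S \<Longrightarrow> f z = h z + cnj (g z)"
  shows "harmonic_on S f"
  unfolding harmonic_on_def
proof (intro conjI ballI)
  show "C_k_on 2 S f" by (rule C_k_on_holomorphic_plus_cnj[OF S hol f])
  fix z assume z: "z \<in> S"
  have "dir_deriv v (dir_deriv v f) z = v * (v * deriv (deriv h) z) + cnj (v * (v * deriv (deriv g) z))"
    for v
  proof -
    have d: "deriv h field_differentiable at z" "deriv g field_differentiable at z"
      using holomorphic_deriv[OF hol(1) S] holomorphic_deriv[OF hol(2) S] S z
      by (auto intro: holomorphic_on_imp_differentiable_at)
    have "dir_deriv v (dir_deriv v f) z =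
        v * deriv (\<lambda>z. v * deriv h z) z + cnj (v * deriv (\<lambda>z. v * deriv g z) z)"
    proof (rule dir_deriv_holomorphic_plus_cnj(2)[OF S z])
      show "(\<lambda>z. v * deriv h z) holomorphic_on S" "(\<lambda>z. v * deriv g z) holomorphic_on S"
        using hol S by (auto intro!: holomorphic_intros)
      show "dir_deriv v f z = v * deriv h z + cnj (v * deriv g z)" if "z \<in> S" for z
        by (rule dir_deriv_holomorphic_plus_cnj(2)[OF S that hol f])
    qed
    then show ?thesis using d by (simp add: deriv_cmult)
  qed
  then show "laplacian f z = 0" unfolding laplacian_def by (simp flip: mult.assoc)
qed

section \<open>The upper bound\<close>

text \<open>
  Here the two estimates are combined. The weight is \<open>1 + k\<close>, one unit for \<open>h\<close> and \<open>k\<close> for \<open>g\<close>,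
  and the threshold for \<open>r\<close> is where the weighted Bohr inequality with this weight stops applying.
\<close>

lemma majorant_le_sup_norm:
  assumes K: "K \<ge> 1" and qc: "bounded_qc_harmonic_mapping K f h g a b"
    and r: "0 \<le> r" "r \<le> (K + 1) / (5 * K + 1)"
  shows "majorant a b r \<le> sup_norm h"
proof -
  define k where "k = (K - 1) / (K + 1)"
  have hol: "h holomorphic_on \<D>" "g holomorphic_on \<D>"
    and f: "\<And>z. z \<in> \<D> \<Longrightarrow> f z = h z + cnj (g z)"
    and h_sums: "\<And>z. z \<in> \<D> \<Longrightarrow> (\<lambda>n. a n * z ^ n) sums h z"
    and g_sums: "\<And>z. z \<in> \<D> \<Longrightarrow> (\<lambda>n. b (Suc n) * z ^ Suc n) sums g z"
    and sp: "\<And>z. z \<in> \<D> \<Longrightarrow> jacobian f z > 0"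
    and dilK: "\<And>z. z \<in> \<D> \<Longrightarrow> (cmod (wirtinger f z) + cmod (wirtinger_bar f z)) /
            (cmod (wirtinger f z) - cmod (wirtinger_bar f z)) \<le> K"
    and bdd: "bounded (h ` \<D>)"
    using qc unfolding bounded_qc_harmonic_mapping_def canonical_representation_def
      sense_preserving_on_def quasiconformal_on_def by auto
  have W: "wirtinger f z = deriv h z" "wirtinger_bar f z = cnj (deriv g z)" if "z \<in> \<D>" for z
    using wirtinger_holomorphic_plus_cnj[OF open_ball that hol f] by auto
  have less: "cmod (deriv g z) < cmod (deriv h z)" if "z \<in> \<D>" for z
    using sp[OF that] unfolding jacobian_def W[OF that] complex_mod_cnj
    by (auto intro: power_less_imp_less_base[of _ 2])
  have nz: "deriv h z \<noteq> 0" if "z \<in> \<D>" for z using less[OF that] by auto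
  have dil: "cmod (deriv g z) \<le> k * cmod (deriv h z)" if "z \<in> \<D>" for z
  proof -
    have "(cmod (deriv h z) + cmod (deriv g z)) / (cmod (deriv h z) - cmod (deriv g z)) \<le> K"
      using dilK[OF that] unfolding W[OF that] complex_mod_cnj .
    then have "cmod (deriv h z) + cmod (deriv g z) \<le> K * (cmod (deriv h z) - cmod (deriv g z))"
      using less[OF that] by (simp add: pos_divide_le_eq)
    then have "(K + 1) * cmod (deriv g z) \<le> (K - 1) * cmod (deriv h z)"
      by (simp add: algebra_simps)
    then show ?thesis using K by (simp add: k_def pos_le_divide_eq mult.commute)
  qed
  have r3: "r \<le> 1 / 3"
  proof -
    have "(K + 1) / (5 * K + 1) \<le> 1 / 3" using K by (simp add: field_simps)
    with r(2) show ?thesis by (rule order_trans)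
  qed
  then have r1: "r < 1" by simp
  have le: "cmod (h z) \<le> sup_norm h" if "z \<in> \<D>" for z
    unfolding sup_norm_def using bdd that
    by (intro cSUP_upper) (auto simp: bounded_iff bdd_above_def)
  have t: "2 * (1 + k) * r \<le> 1 - r"
  proof -
    have "2 * (1 + k) = 4 * K / (K + 1)" using K by (simp add: k_def field_simps)
    moreover have "4 * K * r \<le> (1 - r) * (K + 1)"
      using r(2) K by (simp add: pos_le_divide_eq algebra_simps)
    then have "4 * K / (K + 1) * r \<le> 1 - r" using K by (simp add: pos_divide_le_eq)
    ultimately show ?thesis by simp
  qed
  have k: "k \<ge> 0" using K by (simp add: k_def)
  let ?A = "\<Sum>n. cmod (a (Suc n)) * r ^ Suc n"
  have a_summ: "summable (\<lambda>n. cmod (a n) * r ^ n)"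
    by (rule summable_norm_of_sums_on_disc[OF h_sums r(1) r1])
  have "majorant a b r = cmod (a 0) + ?A + (\<Sum>n. cmod (b (Suc n)) * r ^ Suc n)"
    unfolding majorant_def using suminf_split_head[OF a_summ] by simp
  also have "\<dots> \<le> cmod (a 0) + ?A + k * ?A"
    using majorant_le_of_dilatation_bound[OF hol h_sums g_sums nz dil r(1) r3] by simp
  also have "\<dots> = cmod (a 0) + (1 + k) * ?A" by (simp add: algebra_simps)
  also have "\<dots> \<le> sup_norm h"
    by (rule weighted_bohr_inequality[OF h_sums le r(1) r1]) (use k t in auto)
  finally show ?thesis .
qed

section \<open>Classical derivatives are weak derivatives\<close>

text \<open>
  The Frechet derivative gives directional derivatives as limits of difference quotients, the form
  needed for dominated convergence.
\<close>

lemma difference_quotient_tendsto: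
  fixes u :: "'a::real_normed_vector \<Rightarrow> 'b::real_normed_vector"
  assumes der: "(u has_derivative u') (at x)"
  shows "((\<lambda>t. (u (x + t *\<^sub>R v) - u x) /\<^sub>R t) \<longlongrightarrow> u' v) (at 0)"
proof -
  have "(u has_derivative u') (at (x + 0 *\<^sub>R v))" using der by simp
  moreover have "((\<lambda>t::real. x + t *\<^sub>R v) has_derivative (\<lambda>t. t *\<^sub>R v)) (at 0)"
    by (auto intro!: derivative_eq_intros)
  ultimately have "((\<lambda>t::real. u (x + t *\<^sub>R v)) has_derivative (\<lambda>t. u' (t *\<^sub>R v))) (at 0)"
    by (rule has_derivative_compose[rotated])
  then have "((\<lambda>t::real. norm (u (x + t *\<^sub>R v) - u x - u' (t *\<^sub>R v)) / norm t) \<longlongrightarrow> 0) (at 0)"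
    by (simp add: has_derivative_at)
  then have A: "((\<lambda>t. norm (u (x + t *\<^sub>R v) - u x - t *\<^sub>R u' v) / norm t) \<longlongrightarrow> 0) (at 0)"
    by (simp only: linear_scale[OF has_derivative_linear[OF der]])
  have "norm (u (x + t *\<^sub>R v) - u x - t *\<^sub>R u' v) / norm t =
      norm ((u (x + t *\<^sub>R v) - u x) /\<^sub>R t - u' v)" if "t \<noteq> 0" for t
  proof -
    have "(u (x + t *\<^sub>R v) - u x) /\<^sub>R t - u' v = (u (x + t *\<^sub>R v) - u x - t *\<^sub>R u' v) /\<^sub>R t"
      using that by (simp add: scaleR_diff_right)
    then show ?thesis by (simp add: divide_inverse mult.commute)
  qed
  then have "((\<lambda>t. norm ((u (x + t *\<^sub>R v) - u x) /\<^sub>R t - u' v)) \<longlongrightarrow> 0) (at 0)"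
    by (intro Lim_transform_eventually[OF A]) (simp add: eventually_at_filter)
  then show ?thesis by (simp add: tendsto_norm_zero_iff LIM_zero_iff)
qed

text \<open>
  The difference quotients of \<open>u\<close> have integral \<open>0\<close> by translation invariance of Lebesgue measure.
  They converge pointwise to the derivative, are bounded because \<open>u\<close> is Lipschitz, and vanish outside
  one fixed ball, so dominated convergence passes to the limit.
\<close>

lemma integral_directional_derivative_eq_0:
  fixes u :: "'a::euclidean_space \<Rightarrow> 'b::{banach, second_countable_topology}"
  assumes der: "\<And>x. (u has_derivative u' x) (at x)"
    and C: "compact C" and supp: "\<And>x. x \<notin> C \<Longrightarrow> u x = 0"
    and B: "\<And>x. onorm (u' x) \<le> B"
  shows "(\<integral>x. u' x v \<partial>lborel) = 0"
proof -
  define s where "s = (\<lambda>n x. real (Suc n) *\<^sub>R (u (x + v /\<^sub>R real (Suc n)) - u x))"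
  have cont: "continuous_on UNIV u"
    using der by (intro continuous_at_imp_continuous_on ballI has_derivative_continuous)
  then have meas[measurable]: "u \<in> borel_measurable borel"
    by (rule borel_measurable_continuous_onI)
  have int_u: "integrable lborel u"
  proof -
    have "integrable lborel (\<lambda>x. indicator C x *\<^sub>R u x)"
      by (rule borel_integrable_compact[OF C continuous_on_subset[OF cont]]) simp
    also have "(\<lambda>x. indicator C x *\<^sub>R u x) = u"
      using supp by (auto simp: fun_eq_iff indicator_def)
    finally show ?thesis .
  qed
  have shift: "integrable lborel (\<lambda>x. u (x + c))" "(\<integral>x. u (x + c) \<partial>lborel) = (\<integral>x. u x \<partial>lborel)" for c
  proof -
    have "integrable (distr lborel borel ((+) c)) u" by (simp add: lborel_distr_plus int_u)
    then show "integrable lborel (\<lambda>x. u (x + c))"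
      by (subst (asm) integrable_distr_eq) (auto simp: add.commute)
    have "(\<integral>x. u x \<partial>lborel) = (\<integral>x. u x \<partial>distr lborel borel ((+) c))"
      by (simp add: lborel_distr_plus)
    also have "\<dots> = (\<integral>x. u (x + c) \<partial>lborel)"
      by (subst integral_distr) (auto simp: add.commute)
    finally show "(\<integral>x. u (x + c) \<partial>lborel) = (\<integral>x. u x \<partial>lborel)" by simp
  qed
  have int_s: "(\<integral>x. s n x \<partial>lborel) = 0" for n
    unfolding s_def using shift int_u by simp
  have lim: "(\<lambda>n. s n x) \<longlonglongrightarrow> u' x v" for x
  proof -
    have "((\<lambda>t. (u (x + t *\<^sub>R v) - u x) /\<^sub>R t) \<longlongrightarrow> u' x v) (at 0)"
      by (rule difference_quotient_tendsto[OF der])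
    moreover have "filterlim (\<lambda>n. inverse (real (Suc n))) (at 0) sequentially"
      unfolding filterlim_at using LIMSEQ_inverse_real_of_nat by auto
    ultimately have "(\<lambda>n. (u (x + inverse (real (Suc n)) *\<^sub>R v) - u x) /\<^sub>R inverse (real (Suc n))) \<longlonglongrightarrow> u' x v"
      by (rule filterlim_compose)
    then show ?thesis unfolding s_def by (simp add: inverse_eq_divide)
  qed
  have B0: "B \<ge> 0"
    using B[of 0] onorm_pos_le[OF has_derivative_bounded_linear[OF der[of 0]]] by linarith
  obtain R where R: "\<And>x. x \<in> C \<Longrightarrow> norm x \<le> R"
    using compact_imp_bounded[OF C] by (auto simp: bounded_iff)
  have lip: "norm (u (x + y) - u x) \<le> B * norm y" for x y
    using differentiable_bound[of UNIV u u' B "x + y" x] der B by simp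
  have s_bound: "norm (s n x) \<le> indicator (cball 0 (R + norm v)) x *\<^sub>R (B * norm v)" for n x
  proof (cases "x \<in> cball 0 (R + norm v)")
    case True
    have "norm (s n x) \<le> real (Suc n) * (B * norm (v /\<^sub>R real (Suc n)))"
      unfolding s_def using lip[of x "v /\<^sub>R real (Suc n)"]
      by (simp only: norm_scaleR) (intro mult_mono, auto)
    also have "\<dots> = B * norm v" by (simp add: field_simps)
    finally show ?thesis using True by simp
  next
    case False
    have small: "norm (v /\<^sub>R real (Suc n)) \<le> norm v"
      using mult_right_mono[of 1 "real (Suc n)" "norm v"] by (simp add: field_simps)
    have "x \<notin> C"
    proof
      assume "x \<in> C"
      then have "norm x \<le> R + norm v" using R[of x] norm_ge_zero[of v] by linarith
      then show False using False by simp
    qed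
    moreover have "x + v /\<^sub>R real (Suc n) \<notin> C"
    proof
      assume "x + v /\<^sub>R real (Suc n) \<in> C"
      then have "norm (x + v /\<^sub>R real (Suc n)) \<le> R" by (rule R)
      then have "norm x \<le> R + norm v"
        using small norm_triangle_ineq4[of "x + v /\<^sub>R real (Suc n)" "v /\<^sub>R real (Suc n)"] by simp
      then show False using False by simp
    qed
    ultimately show ?thesis using False by (simp add: s_def supp)
  qed
  have s_meas[measurable]: "s n \<in> borel_measurable lborel" for n
    unfolding s_def by measurable
  have lim_meas: "(\<lambda>x. u' x v) \<in> borel_measurable lborel"
    by (rule borel_measurable_LIMSEQ_metric[OF s_meas]) (use lim in simp)
  have "(\<lambda>n. \<integral>x. s n x \<partial>lborel) \<longlonglongrightarrow> (\<integral>x. u' x v \<partial>lborel)"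
  proof (rule integral_dominated_convergence[OF lim_meas s_meas])
    show "integrable lborel (\<lambda>x::'a. indicator (cball 0 (R + norm v)) x *\<^sub>R (B * norm v))"
      by (rule borel_integrable_compact) auto
  qed (use lim s_bound in auto)
  then show ?thesis by (simp add: int_s LIMSEQ_const_iff)
qed

text \<open>
  The continuity of \<open>F\<close> is only known on \<open>S\<close>, whereas the support condition is global: these are
  the products of a test function on \<open>S\<close> with a function that is arbitrary off \<open>S\<close>.
\<close>

lemma integrable_supported_in_compact:
  fixes F :: "complex \<Rightarrow> complex"
  assumes C: "compact C" "C \<subseteq> S" and cont: "continuous_on S F" and supp: "\<And>x. x \<notin> C \<Longrightarrow> F x = 0"
  shows "integrable lborel (\<lambda>x. indicator S x *\<^sub>R F x)"
    and "bounded (range F)"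
    and "(LINT x:S|lebesgue. F x) = (\<integral>x. indicator S x *\<^sub>R F x \<partial>lborel)"
proof -
  have "integrable lborel (\<lambda>x. indicator C x *\<^sub>R F x)"
    by (rule borel_integrable_compact[OF C(1) continuous_on_subset[OF cont C(2)]])
  also have "(\<lambda>x. indicator C x *\<^sub>R F x) = (\<lambda>x. indicator S x *\<^sub>R F x)"
    using C supp by (auto simp: fun_eq_iff indicator_def)
  finally show int: "integrable lborel (\<lambda>x. indicator S x *\<^sub>R F x)" .
  show "(LINT x:S|lebesgue. F x) = (\<integral>x. indicator S x *\<^sub>R F x \<partial>lborel)"
    unfolding set_lebesgue_integral_def
    by (rule integral_completion) (use int in auto)
  have "bounded (F ` C)"
    by (intro compact_imp_bounded compact_continuous_image continuous_on_subset[OF cont] C)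
  then have "bounded (insert 0 (F ` C))" by simp
  then show "bounded (range F)" by (rule bounded_subset) (use supp in auto)
qed

text \<open>
  The product \<open>\<phi> *\<^sub>R f\<close>, which vanishes off the support of \<open>\<phi>\<close>, is differentiable on the whole
  plane with bounded derivative. The product rule and the vanishing of the integral of
  a directional derivative are then integration by parts.
\<close>

lemma weak_dir_deriv_on_of_C1:
  fixes f :: "complex \<Rightarrow> complex"
  assumes S: "open S" and f: "C_k_on (Suc 0) S f" and v: "v \<in> {1, \<i>}"
  shows "weak_dir_deriv_on S v f (dir_deriv v f)"
  unfolding weak_dir_deriv_on_def
proof (intro allI impI)
  fix \<phi> assume \<phi>: "test_function_on S \<phi>"
  define C where "C = closure {z. \<phi> z \<noteq> 0}"
  have C: "compact C" "C \<subseteq> S" using \<phi> by (auto simp: test_function_on_def C_def)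
  have open_C: "open (- C)" unfolding C_def by (simp add: open_Compl)
  have \<phi>1: "C_k_on (Suc 0) UNIV \<phi>" using \<phi> unfolding test_function_on_def by blast
  have df: "(f has_derivative (\<lambda>w. dir_deriv w f z)) (at z)" if "z \<in> S" for z
    using f that unfolding dir_deriv_def
    by (simp add: differentiable_on_eq_differentiable_at[OF S] flip: frechet_derivative_works)
  have d\<phi>: "(\<phi> has_derivative (\<lambda>w. dir_deriv w \<phi> z)) (at z)" for z
    using \<phi>1 unfolding dir_deriv_def
    by (simp add: differentiable_on_eq_differentiable_at flip: frechet_derivative_works)
  have \<phi>0: "\<phi> z = 0" if "z \<notin> C" for z
    using that closure_subset[of "{z. \<phi> z \<noteq> 0}"] by (auto simp: C_def)
  have d\<phi>0: "dir_deriv w \<phi> z = 0" if "z \<notin> C" for w z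
  proof -
    have "(\<phi> has_derivative (\<lambda>_. 0)) (at z)"
      by (rule has_derivative_transform_within_open[of "\<lambda>_. 0" _ _ UNIV "- C"])
        (use that \<phi>0 open_C in auto)
    from has_derivative_unique[OF d\<phi> this] show ?thesis by (rule fun_cong)
  qed
  define P where "P = (\<lambda>w z. dir_deriv w \<phi> z *\<^sub>R f z)"
  define Q where "Q = (\<lambda>w z. \<phi> z *\<^sub>R dir_deriv w f z)"
  define u where "u = (\<lambda>z. \<phi> z *\<^sub>R f z)"
  have du: "(u has_derivative (\<lambda>w. Q w z + P w z)) (at z)" for z
  proof (cases "z \<in> S")
    case True
    show ?thesis unfolding u_def Q_def P_def
      by (rule has_derivative_scaleR[OF d\<phi> df[OF True]])
  next
    case False
    then have "z \<notin> C" using C by auto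
    then have 0: "(\<lambda>w. Q w z + P w z) = (\<lambda>_. 0)" by (simp add: P_def Q_def \<phi>0 d\<phi>0)
    show ?thesis unfolding 0
      by (rule has_derivative_transform_within_open[of "\<lambda>_. 0" _ _ UNIV "- C"])
        (use \<open>z \<notin> C\<close> \<phi>0 open_C in \<open>auto simp: u_def\<close>)
  qed
  have contf: "continuous_on S f" using f by (simp add: differentiable_imp_continuous_on)
  have cont\<phi>: "continuous_on S \<phi>"
    using \<phi>1 by (auto intro: continuous_on_subset differentiable_imp_continuous_on)
  have cont: "continuous_on S (P w)" "continuous_on S (Q w)" if "w \<in> {1, \<i>}" for w
    unfolding P_def Q_def using f \<phi>1 contf cont\<phi> that
    by (auto intro!: continuous_intros intro: continuous_on_subset)
  have supp: "P w z = 0" "Q w z = 0" if "z \<notin> C" for w z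
    using that by (auto simp: P_def Q_def \<phi>0 d\<phi>0)
  have PI: "integrable lborel (\<lambda>z. indicator S z *\<^sub>R P w z)" "bounded (range (P w))"
      "(LINT z:S|lebesgue. P w z) = (\<integral>z. indicator S z *\<^sub>R P w z \<partial>lborel)"
    and QI: "integrable lborel (\<lambda>z. indicator S z *\<^sub>R Q w z)" "bounded (range (Q w))"
      "(LINT z:S|lebesgue. Q w z) = (\<integral>z. indicator S z *\<^sub>R Q w z \<partial>lborel)"
    if "w \<in> {1, \<i>}" for w
    using integrable_supported_in_compact[OF C cont(1)[OF that]]
      integrable_supported_in_compact[OF C cont(2)[OF that]] supp by auto
  have "\<exists>B. \<forall>z. cmod (Q w z + P w z) \<le> B" if w: "w \<in> {1, \<i>}" for w
  proof -
    obtain B1 B2 where "\<And>z. cmod (P w z) \<le> B1" "\<And>z. cmod (Q w z) \<le> B2"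
      using PI(2)[OF w] QI(2)[OF w] unfolding bounded_iff by blast
    then have "cmod (Q w z + P w z) \<le> B2 + B1" for z
      by (intro norm_triangle_le add_mono)
    then show ?thesis by blast
  qed
  then obtain B1 Bi where B: "\<And>z. cmod (Q 1 z + P 1 z) \<le> B1" "\<And>z. cmod (Q \<i> z + P \<i> z) \<le> Bi"
    by (meson insertI1 insertI2)
  have "(\<integral>z. Q v z + P v z \<partial>lborel) = 0"
  proof (rule integral_directional_derivative_eq_0[OF du C(1)])
    show "u z = 0" if "z \<notin> C" for z using that by (simp add: u_def \<phi>0)
    show "onorm (\<lambda>w. Q w z + P w z) \<le> B1 + Bi" for z
    proof (rule onorm_le)
      fix w
      interpret L: linear "\<lambda>w. Q w z + P w z" by (rule has_derivative_linear[OF du])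
      \<comment> \<open>Boundedness in the two coordinate directions controls the operator norm.\<close>
      have "w = Re w *\<^sub>R 1 + Im w *\<^sub>R \<i>" by (simp add: complex_eq_iff)
      then have "Q w z + P w z = Re w *\<^sub>R (Q 1 z + P 1 z) + Im w *\<^sub>R (Q \<i> z + P \<i> z)"
        by (metis L.add L.scale)
      then have "cmod (Q w z + P w z) \<le> \<bar>Re w\<bar> * cmod (Q 1 z + P 1 z) + \<bar>Im w\<bar> * cmod (Q \<i> z + P \<i> z)"
        by (metis norm_triangle_ineq norm_scaleR)
      also have "\<dots> \<le> cmod w * B1 + cmod w * Bi"
        by (intro add_mono mult_mono B abs_Re_le_cmod abs_Im_le_cmod) auto
      finally show "cmod (Q w z + P w z) \<le> (B1 + Bi) * cmod w" by (simp add: algebra_simps)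
    qed
  qed
  also have "(\<lambda>z. Q v z + P v z) = (\<lambda>z. indicator S z *\<^sub>R Q v z + indicator S z *\<^sub>R P v z)"
    using supp subset_iff[THEN iffD1, OF C(2)] by (fastforce simp: fun_eq_iff indicator_def)
  finally have "(\<integral>z. indicator S z *\<^sub>R Q v z \<partial>lborel) + (\<integral>z. indicator S z *\<^sub>R P v z \<partial>lborel) = 0"
    using PI(1)[OF v] QI(1)[OF v] by simp
  then have "(LINT z:S|lebesgue. P v z) = - (LINT z:S|lebesgue. Q v z)"
    unfolding PI(3)[OF v] QI(3)[OF v] by (simp add: eq_neg_iff_add_eq_0 add.commute)
  then show "(LINT z:S|lebesgue. dir_deriv v \<phi> z *\<^sub>R f z) = - (LINT z:S|lebesgue. \<phi> z *\<^sub>R dir_deriv v f z)"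
    by (simp add: P_def Q_def)
qed

lemma L2_loc_on_continuous:
  assumes "continuous_on S u" shows "L2_loc_on S u"
  unfolding L2_loc_on_def
proof (intro allI impI)
  fix C assume "compact C \<and> C \<subseteq> S"
  then have C: "compact C" and cont: "continuous_on C u"
    using assms continuous_on_subset by auto
  have "set_borel_measurable lebesgue C u"
    unfolding set_borel_measurable_def
    by (intro measurable_completion)
      (use borel_measurable_continuous_on_indicator[OF _ cont] C in \<open>simp add: borel_compact\<close>)
  moreover have "set_integrable lborel C (\<lambda>z. (cmod (u z))\<^sup>2)"
    unfolding set_integrable_def
    by (intro borel_integrable_compact[OF C] continuous_intros cont)
  then have "set_integrable lebesgue C (\<lambda>z. (cmod (u z))\<^sup>2)"
    unfolding set_integrable_def
    by (subst integrable_completion) auto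
  ultimately show "set_borel_measurable lebesgue C u \<and> set_integrable lebesgue C (\<lambda>z. (cmod (u z))\<^sup>2)" ..
qed

lemma W12_loc_on_of_C1:
  assumes S: "open S" and f: "C_k_on (Suc 0) S f"
  shows "W12_loc_on S f"
  unfolding W12_loc_on_def
proof (intro conjI ballI exI)
  show "L2_loc_on S f"
    using f by (intro L2_loc_on_continuous) (simp add: differentiable_imp_continuous_on)
  fix v :: complex assume v: "v \<in> {1, \<i>}"
  show "L2_loc_on S (dir_deriv v f)"
    using f v by (intro L2_loc_on_continuous) auto
  show "weak_dir_deriv_on S v f (dir_deriv v f)"
    by (rule weak_dir_deriv_on_of_C1[OF S f v])
qed

section \<open>Sharpness\<close>

text \<open>
  The disc automorphism \<open>h z = (\<alpha> - z) / (1 - \<alpha> * z)\<close> has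
  \<open>cmod (a n) = (1 - \<alpha>\<^sup>2) * \<alpha> ^ (n - 1)\<close> for \<open>n \<ge> 1\<close>, which for \<open>\<alpha>\<close> near \<open>1\<close> is close to the
  value \<open>1 - \<alpha>\<^sup>2\<close> allowed by Wiener's bound. With \<open>g = k * (h - \<alpha>)\<close> the dilatation is constant, so the bound on the majorant
  of \<open>g\<close> is attained.
\<close>

lemma Moebius_extremal_qc_mapping:
  fixes K \<alpha> :: real
  assumes K: "K \<ge> 1" and \<alpha>: "0 < \<alpha>" "\<alpha> < 1"
  obtains f h g a b where "bounded_qc_harmonic_mapping K f h g a b" "sup_norm h \<le> 1"
    "\<And>r. 0 \<le> r \<Longrightarrow> r < 1 \<Longrightarrow>
       majorant a b r = \<alpha> + (1 + (K - 1) / (K + 1)) * ((1 - \<alpha>\<^sup>2) * (r / (1 - \<alpha> * r)))"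
proof -
  define k where "k = (K - 1) / (K + 1)"
  define h where "h = (\<lambda>z::complex. (\<alpha> - z) / (1 - \<alpha> * z))"
  define a where "a = (\<lambda>n. if n = 0 then complex_of_real \<alpha> else - of_real ((1 - \<alpha>\<^sup>2) * \<alpha> ^ (n - 1)))"
  have k: "0 \<le> k" "k < 1" using K by (auto simp: k_def)
  have k_K: "(1 + k) / (1 - k) = K"
    using K by (simp add: k_def field_simps)
  define g where "g = (\<lambda>z. k * (h z - \<alpha>))"
  define f where "f = (\<lambda>z. h z + cnj (g z))"
  have h_Moebius: "h z = - Moebius_function 0 \<alpha> z" for z
    unfolding h_def Moebius_function_simple by (subst minus_divide_left) simp
  have small: "cmod (\<alpha> * z) < 1" if "z \<in> \<D>" for z :: complex
    using that \<alpha> mult_strict_mono[of \<alpha> 1 "cmod z" 1] by (simp add: norm_mult)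
  have nz: "1 - \<alpha> * z \<noteq> 0" if "z \<in> \<D>" for z :: complex
    using small[OF that] by auto
  have h_less: "cmod (h z) < 1" if "z \<in> \<D>" for z
    using Moebius_function_norm_lt_1[of \<alpha> z 0] that \<alpha> by (simp add: h_Moebius)
  have hol_h: "h holomorphic_on \<D>"
    unfolding h_def using nz by (auto intro!: holomorphic_intros)
  then have hol_g: "g holomorphic_on \<D>"
    unfolding g_def by (auto intro!: holomorphic_intros)
  have f_eq: "f z = h z + cnj (g z)" for z by (simp add: f_def)
  have dh: "deriv h z = - of_real (1 - \<alpha>\<^sup>2) / (1 - \<alpha> * z)\<^sup>2" if "z \<in> \<D>" for z :: complex
  proof (rule DERIV_imp_deriv)
    show "(h has_field_derivative - of_real (1 - \<alpha>\<^sup>2) / (1 - \<alpha> * z)\<^sup>2) (at z)"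
      unfolding h_def using nz[OF that]
      by (auto intro!: derivative_eq_intros simp: power2_eq_square) (simp add: algebra_simps power2_eq_square)
  qed
  have \<alpha>2: "\<alpha>\<^sup>2 < 1" using \<alpha> by (simp add: power_less_one_iff)
  have dh_nz: "deriv h z \<noteq> 0" if "z \<in> \<D>" for z
  proof -
    have "complex_of_real (1 - \<alpha>\<^sup>2) \<noteq> 0" using \<alpha>2 unfolding of_real_eq_0_iff by simp
    then show ?thesis using nz[OF that] dh[OF that] by simp
  qed
  have dg: "deriv g z = k * deriv h z" if "z \<in> \<D>" for z
    unfolding g_def
    by (rule DERIV_imp_deriv)
      (auto intro!: derivative_eq_intros holomorphic_derivI[OF hol_h open_ball that])
  have W: "wirtinger f z = deriv h z" "wirtinger_bar f z = cnj (k * deriv h z)" if "z \<in> \<D>" for z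
    using wirtinger_holomorphic_plus_cnj[OF open_ball that hol_h hol_g f_eq] dg[OF that] by auto
  have sp: "sense_preserving_on \<D> f"
    unfolding sense_preserving_on_def
  proof
    fix z assume z: "z \<in> \<D>"
    have "jacobian f z = (1 - k\<^sup>2) * (cmod (deriv h z))\<^sup>2"
      unfolding jacobian_def W[OF z] complex_mod_cnj using k
      by (simp add: norm_mult power_mult_distrib algebra_simps)
    moreover have "k\<^sup>2 < 1" using k by (simp add: power_less_one_iff)
    ultimately show "jacobian f z > 0" using dh_nz[OF z] by simp
  qed
  have C1: "C_k_on n \<D> f" for n
    by (rule C_k_on_holomorphic_plus_cnj[OF open_ball hol_h hol_g f_eq])
  have diff: "f differentiable_on \<D>" using C1[of "Suc 0"] by simp
  have inj: "inj_on f \<D>"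
  proof (rule inj_onI)
    fix z w assume z: "z \<in> \<D>" and w: "w \<in> \<D>" and eq: "f z = f w"
    have "h z - h w = - (k * cnj (h z - h w))"
      using eq by (simp add: f_def g_def algebra_simps)
    \<comment> \<open>The conjugate-linear part contracts by \<open>k < 1\<close>, so it cannot cancel the linear one.\<close>
    then have "cmod (h z - h w) = k * cmod (h z - h w)"
      using k by (metis norm_minus_cancel norm_mult norm_of_real abs_of_nonneg complex_mod_cnj)
    then have "h z = h w" using k by simp
    then have "Moebius_function 0 (-\<alpha>) (Moebius_function 0 \<alpha> z) = Moebius_function 0 (-\<alpha>) (Moebius_function 0 \<alpha> w)"
      by (simp add: h_Moebius)
    then show "z = w"
      using Moebius_function_compose[of "-\<alpha>" \<alpha> z] Moebius_function_compose[of "-\<alpha>" \<alpha> w] z w \<alpha> by simp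
  qed
  have cont: "continuous_on \<D> f" by (rule differentiable_imp_continuous_on[OF diff])
  obtain f' where homeo: "homeomorphism \<D> (f ` \<D>) f f'"
    using invariance_of_domain_homeomorphism[OF open_ball cont _ inj] by auto
  have "open (f ` \<D>)" by (rule invariance_of_domain[OF cont open_ball inj])
  moreover have "connected (f ` \<D>)" by (rule connected_continuous_image[OF cont]) simp
  moreover have "(cmod (wirtinger f z) + cmod (wirtinger_bar f z)) /
      (cmod (wirtinger f z) - cmod (wirtinger_bar f z)) \<le> K" if z: "z \<in> \<D>" for z
  proof -
    have "(cmod (wirtinger f z) + cmod (wirtinger_bar f z)) /
        (cmod (wirtinger f z) - cmod (wirtinger_bar f z)) =
        (cmod (deriv h z) * (1 + k)) / (cmod (deriv h z) * (1 - k))"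
      unfolding W[OF z] complex_mod_cnj using k by (simp add: norm_mult algebra_simps)
    also have "\<dots> = K" using dh_nz[OF z] k_K by simp
    finally show ?thesis by simp
  qed
  ultimately have qc: "quasiconformal_on K \<D> f"
    unfolding quasiconformal_on_def using K diff sp homeo W12_loc_on_of_C1[OF open_ball C1] by blast
  have tail_sums: "(\<lambda>n. a (Suc n) * z ^ Suc n) sums (h z - \<alpha>)" if z: "z \<in> \<D>" for z
  proof -
    have "(\<lambda>n. - of_real (1 - \<alpha>\<^sup>2) * z * (\<alpha> * z) ^ n) sums (- of_real (1 - \<alpha>\<^sup>2) * z * (1 / (1 - \<alpha> * z)))"
      by (intro sums_mult geometric_sums small[OF z])
    also have "- of_real (1 - \<alpha>\<^sup>2) * z * (1 / (1 - \<alpha> * z)) = h z - \<alpha>"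
      using nz[OF z] by (simp add: h_def field_simps power2_eq_square)
    also have "(\<lambda>n. - of_real (1 - \<alpha>\<^sup>2) * z * (\<alpha> * z) ^ n) = (\<lambda>n. a (Suc n) * z ^ Suc n)"
      by (simp add: fun_eq_iff a_def power_mult_distrib algebra_simps)
    finally show ?thesis .
  qed
  have h_sums: "(\<lambda>n. a n * z ^ n) sums h z" if z: "z \<in> \<D>" for z
    using tail_sums[OF z] sums_Suc_iff[of "\<lambda>n. a n * z ^ n" "h z - \<alpha>"] by (simp add: a_def)
  have g_sums: "(\<lambda>n. k * a (Suc n) * z ^ Suc n) sums g z" if z: "z \<in> \<D>" for z
    unfolding g_def mult.assoc by (intro sums_mult tail_sums[OF z])
  have "canonical_representation f h g a (\<lambda>n. k * a n)"
    unfolding canonical_representation_def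
    using hol_h hol_g h_sums g_sums f_eq by (auto simp: g_def h_def)
  moreover have "bounded (h ` \<D>)"
    using h_less unfolding bounded_iff by (auto intro!: exI[of _ 1] less_imp_le)
  ultimately have mapping: "bounded_qc_harmonic_mapping K f h g a (\<lambda>n. k * a n)"
    unfolding bounded_qc_harmonic_mapping_def
    using harmonic_on_holomorphic_plus_cnj[OF open_ball hol_h hol_g f_eq] sp qc by blast
  have sup: "sup_norm h \<le> 1"
    unfolding sup_norm_def using h_less by (intro cSUP_least) (auto intro: less_imp_le)
  have norm_a: "cmod (a (Suc n)) = (1 - \<alpha>\<^sup>2) * \<alpha> ^ n" for n
    using \<alpha> \<alpha>2 by (simp add: a_def norm_mult norm_power abs_mult del: of_real_mult of_real_power of_real_diff)
  have "majorant a (\<lambda>n. k * a n) r = \<alpha> + (1 + k) * ((1 - \<alpha>\<^sup>2) * (r / (1 - \<alpha> * r)))"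
    if r: "0 \<le> r" "r < 1" for r
  proof -
    have "\<alpha> * r < 1" using \<alpha> r mult_strict_mono[of \<alpha> 1 r 1] by simp
    then have "(\<lambda>n. (1 - \<alpha>\<^sup>2) * r * (\<alpha> * r) ^ n) sums ((1 - \<alpha>\<^sup>2) * r * (1 / (1 - \<alpha> * r)))"
      using \<alpha> r by (intro sums_mult geometric_sums) simp
    then have tail: "(\<lambda>n. cmod (a (Suc n)) * r ^ Suc n) sums ((1 - \<alpha>\<^sup>2) * (r / (1 - \<alpha> * r)))"
      by (simp add: norm_a power_mult_distrib mult_ac)
    have "(\<lambda>n. cmod (a n) * r ^ n) sums (\<alpha> + (1 - \<alpha>\<^sup>2) * (r / (1 - \<alpha> * r)))"
      using tail sums_Suc_iff[of "\<lambda>n. cmod (a n) * r ^ n" "(1 - \<alpha>\<^sup>2) * (r / (1 - \<alpha> * r))"] \<alpha>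
      by (simp add: a_def add.commute)
    moreover have "(\<lambda>n. cmod (k * a (Suc n)) * r ^ Suc n) sums (k * ((1 - \<alpha>\<^sup>2) * (r / (1 - \<alpha> * r))))"
      using sums_mult[OF tail, of k] k by (simp add: norm_mult mult.assoc)
    ultimately show ?thesis
      unfolding majorant_def by (simp only: sums_iff distrib_right mult_1 add.assoc)
  qed
  then show thesis by (intro that[OF mapping sup]) (simp add: k_def)
qed

text \<open>
  Cancelling \<open>1 - \<alpha>\<close> shows that the majorant of the extremal mapping exceeds \<open>1\<close> iff
  \<open>(1 + k) * (1 + \<alpha>) * r > 1 - \<alpha> * r\<close>. In the limit \<open>\<alpha> \<rightarrow> 1\<close> this is
  \<open>2 * (1 + k) * r > 1 - r\<close>, i.e. \<open>r > (K + 1) / (5 * K + 1)\<close>, and the strict inequality persists for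
  \<open>\<alpha>\<close> near \<open>1\<close>.
\<close>

lemma exists_mapping_violating_majorant_bound:
  assumes K: "K \<ge> 1" and r: "(K + 1) / (5 * K + 1) < r" "r < 1"
  shows "\<exists>f h g a b. bounded_qc_harmonic_mapping K f h g a b \<and> \<not> majorant a b r \<le> sup_norm h"
proof -
  define k where "k = (K - 1) / (K + 1)"
  have r0: "0 < r" using r(1) K by (smt (verit) divide_pos_pos)
  have k: "1 + k > 0" "1 + k = 2 * K / (K + 1)" using K by (auto simp: k_def field_simps)
  have "K + 1 < (5 * K + 1) * r" using r K by (simp add: pos_divide_less_eq mult.commute)
  then have "(1 - r) * (K + 1) < 4 * K * r" by (simp add: algebra_simps)
  then have "1 - r < 4 * K * r / (K + 1)" using K by (simp add: pos_less_divide_eq)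
  also have "\<dots> = (1 + k) * 2 * r" by (simp add: k)
  finally have gap: "1 - 1 * r < (1 + k) * (1 + 1) * r" by simp
  have "((\<lambda>\<alpha>. (1 + k) * (1 + \<alpha>) * r - (1 - \<alpha> * r)) \<longlongrightarrow> (1 + k) * (1 + 1) * r - (1 - 1 * r)) (at_left 1)"
    by (intro tendsto_intros)
  then have "eventually (\<lambda>\<alpha>. (1 + k) * (1 + \<alpha>) * r - (1 - \<alpha> * r) > 0) (at_left 1)"
    by (rule order_tendstoD) (use gap in simp)
  moreover have "eventually (\<lambda>\<alpha>::real. \<alpha> \<in> {0<..<1}) (at_left 1)"
    by (rule eventually_at_left_real) simp
  ultimately have "eventually (\<lambda>\<alpha>. 0 < \<alpha> \<and> \<alpha> < 1 \<and> 1 - \<alpha> * r < (1 + k) * (1 + \<alpha>) * r) (at_left 1)"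
    by eventually_elim auto
  then obtain \<alpha> where \<alpha>: "0 < \<alpha>" "\<alpha> < 1" and big: "1 - \<alpha> * r < (1 + k) * (1 + \<alpha>) * r"
    using eventually_happens'[OF trivial_limit_at_left_real] by blast
  have pos: "1 - \<alpha> * r > 0" using \<alpha> r r0 mult_strict_mono[of \<alpha> 1 r 1] by simp
  have "1 < (1 + k) * (1 + \<alpha>) * r / (1 - \<alpha> * r)" using big pos by (simp add: pos_less_divide_eq)
  then have "(1 - \<alpha>) * 1 < (1 - \<alpha>) * ((1 + k) * (1 + \<alpha>) * r / (1 - \<alpha> * r))"
    using \<alpha> by (intro mult_strict_left_mono) auto
  also have "\<dots> = (1 + k) * ((1 - \<alpha>\<^sup>2) * (r / (1 - \<alpha> * r)))"
    by (simp add: power2_eq_square algebra_simps)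
  finally have "1 < \<alpha> + (1 + k) * ((1 - \<alpha>\<^sup>2) * (r / (1 - \<alpha> * r)))" by simp
  moreover obtain f h g a b where "bounded_qc_harmonic_mapping K f h g a b" "sup_norm h \<le> 1"
    "majorant a b r = \<alpha> + (1 + k) * ((1 - \<alpha>\<^sup>2) * (r / (1 - \<alpha> * r)))"
    unfolding k_def using Moebius_extremal_qc_mapping[OF K \<alpha>] r0 r(2) by (metis less_imp_le)
  ultimately have "bounded_qc_harmonic_mapping K f h g a b \<and> \<not> majorant a b r \<le> sup_norm h"
    by simp
  then show ?thesis by blast
qed

theorem theorem1:
  fixes K :: real
  assumes "K \<ge> 1"
  shows "(\<forall>f h g a b. bounded_qc_harmonic_mapping K f h g a b \<longrightarrow>
            (\<forall>r. 0 \<le> r \<and> r \<le> (K + 1) / (5 * K + 1) \<longrightarrow> majorant a b r \<le> sup_norm h))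
       \<and> (\<forall>r. (K + 1) / (5 * K + 1) < r \<and> r < 1 \<longrightarrow>
            (\<exists>f h g a b. bounded_qc_harmonic_mapping K f h g a b \<and>
               \<not> majorant a b r \<le> sup_norm h))"
  using majorant_le_sup_norm[OF assms] exists_mapping_violating_majorant_bound[OF assms] by blast

end
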